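(* Write $\{a_0,\dots,a_k\}=\bigsqcup_{j=0}^r[b_{2j},b_{2j+1}]$ (disjoint union of integer intervals), where $r\ge1$, $0=:b_0\le b_1<b_2\le b_3<\cdots<b_{2r}\le b_{2r+1}:=d$, and $b_{2j-1}+2\le b_{2j}$ for $j=1,\dots,r$. Assume that $a_1=1$. If there is $1\le j\le r$ such that $b_{2j+1}-b_{2j-1}\ge\lambda_k+2$, where $\lambda_k=a_k-a_{k-1}-1$ is the last gap (which could be zero), then $K[S]$ is not a Cohen--Macaulay ring.
   Context: Let $K$ be a field, $k\ge 3$, and let $0=:a_0<a_1<\cdots<a_k=:d$ be integers with $\gcd(a_1,\dots,a_k)=1$. For integers $p\le q$, $[p,q]$ denotes the set of integers $n$ with $p\le n\le q$. Let $S\subset\mathbb N^2$ be the additive monoid generated by $(a_i,d-a_i)$, $0\le i\le k$, and $K[S]$ its semigroup ring over $K$ (isomorphic to $K[s^{a_i}t^{d-a_i}\mid 0\le i\le k]$). *)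

theory Defs
  imports
    "HOL-Library.Poly_Mapping"
    "HOL-Library.Product_Plus"
    "HOL-Library.Extended_Nat"
    "HOL-Algebra.Ring_Divisibility"
begin

inductive_set monoid_hull :: "'a::comm_monoid_add set \<Rightarrow> 'a set" for G where
  zero: "0 \<in> monoid_hull G"
| add: "g \<in> G \<Longrightarrow> x \<in> monoid_hull G \<Longrightarrow> g + x \<in> monoid_hull G"

(* Finitely supported functions 'a => 'k with convolution product: the monoid ring of the
   whole type 'a. For an additive submonoid S, the elements supported in S form the
   semigroup ring k[S], where k is the field given by the type 'k. *)
definition semigroup_ring :: "'a::comm_monoid_add set \<Rightarrow> ('a \<Rightarrow>\<^sub>0 'k::field) ring" where
  "semigroup_ring S =
     \<lparr>carrier = {f. Poly_Mapping.keys f \<subseteq> S}, mult = (*), one = 1, zero = 0, add = (+)\<rparr>"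

definition projective_monoid :: "nat \<Rightarrow> (nat \<Rightarrow> nat) \<Rightarrow> (nat \<times> nat) set" where
  "projective_monoid k a = monoid_hull ((\<lambda>i. (a i, a k - a i)) ` {0..k})"

definition regular_sequence :: "('a, 'b) ring_scheme \<Rightarrow> 'a list \<Rightarrow> bool" where
  "regular_sequence R xs \<longleftrightarrow>
     set xs \<subseteq> carrier R \<and>
     genideal R (set xs) \<noteq> carrier R \<and>
     (\<forall>i<length xs. \<forall>y\<in>carrier R.
        xs ! i \<otimes>\<^bsub>R\<^esub> y \<in> genideal R (set (take i xs)) \<longrightarrow> y \<in> genideal R (set (take i xs)))"

definition ideal_depth :: "('a, 'b) ring_scheme \<Rightarrow> 'a set \<Rightarrow> enat" where
  "ideal_depth R I = (SUP xs\<in>{xs. regular_sequence R xs \<and> set xs \<subseteq> I}. enat (length xs))"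

definition prime_height :: "('a, 'b) ring_scheme \<Rightarrow> 'a set \<Rightarrow> enat" where
  "prime_height R P =
     (SUP n\<in>{n. \<exists>Q. (\<forall>i\<le>n. primeideal (Q i) R) \<and> (\<forall>i<n. Q i \<subset> Q (Suc i)) \<and> Q n = P}. enat n)"

(* The definition of Eisenbud, Commutative Algebra, Section 18.2: depth equals codimension
   (height) at every maximal ideal. For Noetherian rings, ideal_depth R P and
   prime_height R P are the depth and the dimension of the localisation R_P. *)
definition cohen_macaulay :: "('a, 'b) ring_scheme \<Rightarrow> bool" where
  "cohen_macaulay R \<longleftrightarrow>
     cring R \<and> noetherian_ring R \<and> (\<forall>P. maximalideal P R \<longrightarrow> ideal_depth R P = prime_height R P)"

end

theory Submission imports Defs begin

text \<open>The ring has dimension at least 2 at its irrelevant maximal ideal, as the faces of the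
  quadrant give a chain of monomial primes. Its depth there is at most 1 as soon as some lattice
  point \<open>z\<close> outside the monoid satisfies \<open>s + z \<in> S\<close> for all nonzero \<open>s \<in> S\<close>. Such a \<open>z\<close> exists once
  some \<open>x\<close> outside \<open>S\<close> is moved into \<open>S\<close> by a multiple of each generator. With \<open>g = \<lambda>\<^sub>k + 1\<close> and
  \<open>y = max b\<^bsub>2j\<^esub> (b\<^bsub>2j-1\<^esub> + g + 1)\<close>, which the hypothesis places in the \<open>j\<close>-th interval, the point
  \<open>x = (y - g, d - y + g)\<close> qualifies: \<open>y - g\<close> lies in the gap before \<open>b\<^bsub>2j\<^esub>\<close>, while
  \<open>x + (d, 0) = (y, d - y) + (d - g, g)\<close> and \<open>a\<^sub>1 = 1\<close> handles the generator \<open>(0, d)\<close>.\<close>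

section \<open>Unique sums and non-cancelling coefficients of products\<close>

text \<open>The hypothesis leaves only the index \<open>l = u\<close> in the convolution sum, and
  cancellation then pins the other index to \<open>v\<close>. Such a coefficient cannot cancel,
  which later proves products nonzero.\<close>

lemma lookup_mult_unique:
  fixes f g :: "'a::cancel_comm_monoid_add \<Rightarrow>\<^sub>0 'k::semiring_0"
  assumes "\<And>x y. x \<in> Poly_Mapping.keys f \<Longrightarrow> y \<in> Poly_Mapping.keys g \<Longrightarrow> x + y = u + v \<Longrightarrow> x = u"
  shows "Poly_Mapping.lookup (f * g) (u + v) = Poly_Mapping.lookup f u * Poly_Mapping.lookup g v"
proof -
  have eq: "Poly_Mapping.lookup f l * (\<Sum>q. Poly_Mapping.lookup g q when u + v = l + q) =
      (Poly_Mapping.lookup f l * Poly_Mapping.lookup g v when l = u)" for l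
  proof (cases "l = u")
    case True
    have "(\<Sum>q. Poly_Mapping.lookup g q when u + v = u + q) = (\<Sum>q. Poly_Mapping.lookup g q when q = v)"
      by (rule arg_cong[where f = Sum_any]) (auto simp: fun_eq_iff when_def)
    with True show ?thesis by simp
  next
    case False
    show ?thesis
    proof (cases "Poly_Mapping.lookup f l = 0")
      case False
      then have l: "l \<in> Poly_Mapping.keys f" by (simp add: in_keys_iff)
      have "(Poly_Mapping.lookup g q when u + v = l + q) = 0" for q
        using assms[OF l, of q] \<open>l \<noteq> u\<close> by (force simp: when_def in_keys_iff)
      with \<open>l \<noteq> u\<close> show ?thesis by simp
    qed (use False in simp)
  qed
  show ?thesis
    unfolding lookup_mult eq by (rule Sum_any_when_equal)
qed

text \<open>The weight \<^term>\<open>(\<lambda>u. fst u * w + snd u)\<close> is additive, and injective once \<open>w\<close> exceeds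
  all second coordinates; its maximizers form a unique sum.\<close>
lemma unique_sum_exists:
  fixes A B :: "(nat \<times> nat) set"
  assumes "finite A" "finite B" "A \<noteq> {}" "B \<noteq> {}"
  obtains u v where "u \<in> A" "v \<in> B"
    "\<And>x y. x \<in> A \<Longrightarrow> y \<in> B \<Longrightarrow> x + y = u + v \<Longrightarrow> x = u"
proof -
  obtain w where w: "\<And>x. x \<in> A \<Longrightarrow> snd x < w"
    using finite_nat_set_iff_bounded[of "snd ` A"] \<open>finite A\<close> by auto
  define \<phi> where "\<phi> = (\<lambda>u :: nat \<times> nat. fst u * w + snd u)"
  have add: "\<phi> (x + y) = \<phi> x + \<phi> y" for x y
    by (simp add: \<phi>_def algebra_simps)
  have inj: "x = y" if "x \<in> A" "y \<in> A" "\<phi> x = \<phi> y" for x y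
  proof -
    have "fst x = \<phi> x div w" "snd x = \<phi> x mod w" "fst y = \<phi> y div w" "snd y = \<phi> y mod w"
      using w[OF that(1)] w[OF that(2)] by (auto simp: \<phi>_def)
    with that(3) show ?thesis by (simp add: prod_eq_iff)
  qed
  have "Max (\<phi> ` A) \<in> \<phi> ` A" "Max (\<phi> ` B) \<in> \<phi> ` B"
    using assms by (intro Max_in; simp)+
  then obtain u v where uv: "u \<in> A" "\<phi> u = Max (\<phi> ` A)" "v \<in> B" "\<phi> v = Max (\<phi> ` B)"
    by (metis imageE)
  have "x = u" if "x \<in> A" "y \<in> B" "x + y = u + v" for x y
  proof -
    have "\<phi> x \<le> \<phi> u" "\<phi> y \<le> \<phi> v" using that assms uv by auto
    moreover have "\<phi> x + \<phi> y = \<phi> u + \<phi> v" using that(3) add by metis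
    ultimately show ?thesis using inj[OF that(1) uv(1)] by simp
  qed
  with uv that show thesis by blast
qed

section \<open>Faces and their monomial ideals\<close>

text \<open>The equivalence combines two properties: \<open>F\<close> is a submonoid, and its
  complement is a prime ideal of the monoid.\<close>

definition face :: "'a::comm_monoid_add set \<Rightarrow> bool" where
  "face F \<longleftrightarrow> 0 \<in> F \<and> (\<forall>x y. x + y \<in> F \<longleftrightarrow> x \<in> F \<and> y \<in> F)"

lemma face_add_iff: "face F \<Longrightarrow> x + y \<in> F \<longleftrightarrow> x \<in> F \<and> y \<in> F"
  by (simp add: face_def)

text \<open>The span of the monomials of \<open>S\<close> off the face. The face \<open>UNIV\<close>
  yields the zero ideal and \<open>{0}\<close> the irrelevant ideal.\<close>

definition face_ideal :: "'a::comm_monoid_add set \<Rightarrow> 'a set \<Rightarrow> ('a \<Rightarrow>\<^sub>0 'k::field) set" where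
  "face_ideal S F = {f. Poly_Mapping.keys f \<subseteq> S - F}"

text \<open>This is the primality of face ideals. Only pairs from \<open>F\<close> can sum into
  \<open>F\<close>, so a sum that is unique among the keys in \<open>F\<close> is unique among all
  keys.\<close>

lemma keys_mult_meets_face:
  fixes f g :: "nat \<times> nat \<Rightarrow>\<^sub>0 'k::field"
  assumes "face F" "Poly_Mapping.keys f \<inter> F \<noteq> {}" "Poly_Mapping.keys g \<inter> F \<noteq> {}"
  shows "Poly_Mapping.keys (f * g) \<inter> F \<noteq> {}"
proof -
  obtain u v where uv: "u \<in> Poly_Mapping.keys f \<inter> F" "v \<in> Poly_Mapping.keys g \<inter> F"
    and unique: "\<And>x y. x \<in> Poly_Mapping.keys f \<inter> F \<Longrightarrow> y \<in> Poly_Mapping.keys g \<inter> F \<Longrightarrow> x + y = u + v \<Longrightarrow> x = u"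
    by (rule unique_sum_exists[OF _ _ assms(2,3)]) simp_all
  have F: "u + v \<in> F" using assms(1) uv by (simp add: face_add_iff)
  have summands: "x \<in> F \<and> y \<in> F" if "x + y = u + v" for x y
    using face_add_iff[OF assms(1), of x y] F that by simp
  have "Poly_Mapping.lookup (f * g) (u + v) = Poly_Mapping.lookup f u * Poly_Mapping.lookup g v"
    by (rule lookup_mult_unique) (use unique summands in blast)
  then have "u + v \<in> Poly_Mapping.keys (f * g)"
    using uv by (simp add: in_keys_iff)
  with F show ?thesis by blast
qed

lemma poly_mapping_mult_eq_0:
  fixes f g :: "nat \<times> nat \<Rightarrow>\<^sub>0 'k::field"
  assumes "f * g = 0"
  shows "f = 0 \<or> g = 0"
  using keys_mult_meets_face[of UNIV f g] assms by (auto simp: face_def)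

lemma cring_semigroup_ring:
  fixes S :: "'a::comm_monoid_add set"
  assumes "0 \<in> S" "\<And>x y. x \<in> S \<Longrightarrow> y \<in> S \<Longrightarrow> x + y \<in> S"
  shows "cring (semigroup_ring S :: ('a \<Rightarrow>\<^sub>0 'k::field) ring)"
proof (rule cringI)
  have add: "f + g \<in> carrier (semigroup_ring S)"
    if "f \<in> carrier (semigroup_ring S)" "g \<in> carrier (semigroup_ring S)" for f g :: "'a \<Rightarrow>\<^sub>0 'k"
    using that keys_add[of f g] by (auto simp: semigroup_ring_def)
  have mult: "f * g \<in> carrier (semigroup_ring S)"
    if "f \<in> carrier (semigroup_ring S)" "g \<in> carrier (semigroup_ring S)" for f g :: "'a \<Rightarrow>\<^sub>0 'k"
    using that assms(2) keys_mult[of f g] by (fastforce simp: semigroup_ring_def)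
  show "abelian_group (semigroup_ring S :: ('a \<Rightarrow>\<^sub>0 'k) ring)"
  proof (rule abelian_groupI)
    fix f :: "'a \<Rightarrow>\<^sub>0 'k" assume "f \<in> carrier (semigroup_ring S)"
    then show "\<exists>g\<in>carrier (semigroup_ring S). g \<oplus>\<^bsub>semigroup_ring S\<^esub> f = \<zero>\<^bsub>semigroup_ring S\<^esub>"
      by (intro bexI[of _ "- f"]) (auto simp: semigroup_ring_def in_keys_iff)
  qed (use add in \<open>auto simp: semigroup_ring_def algebra_simps\<close>)
  show "comm_monoid (semigroup_ring S :: ('a \<Rightarrow>\<^sub>0 'k) ring)"
    by (rule comm_monoidI) (use mult assms(1) in \<open>auto simp: semigroup_ring_def algebra_simps\<close>)
qed (auto simp: semigroup_ring_def algebra_simps)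

lemma ideal_face_ideal:
  fixes S :: "'a::comm_monoid_add set"
  assumes "0 \<in> S" "\<And>x y. x \<in> S \<Longrightarrow> y \<in> S \<Longrightarrow> x + y \<in> S" "face F"
  shows "ideal (face_ideal S F) (semigroup_ring S :: ('a \<Rightarrow>\<^sub>0 'k::field) ring)"
proof -
  interpret cring "semigroup_ring S :: ('a \<Rightarrow>\<^sub>0 'k) ring"
    by (rule cring_semigroup_ring[OF assms(1,2)])
  have mult: "f * g \<in> face_ideal S F"
    if "f \<in> face_ideal S F" "g \<in> carrier (semigroup_ring S)" for f g :: "'a \<Rightarrow>\<^sub>0 'k"
    using that assms(2) keys_mult[of f g]
    by (fastforce simp: face_ideal_def semigroup_ring_def face_add_iff[OF assms(3)])
  have inv: "\<ominus>\<^bsub>semigroup_ring S\<^esub> f = - f" if "f \<in> carrier (semigroup_ring S)" for f :: "'a \<Rightarrow>\<^sub>0 'k"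
  proof (rule minus_equality)
    show "- f \<oplus>\<^bsub>semigroup_ring S\<^esub> f = \<zero>\<^bsub>semigroup_ring S\<^esub>" by (simp add: semigroup_ring_def)
  qed (use that in \<open>auto simp: semigroup_ring_def in_keys_iff\<close>)
  show ?thesis
  proof (rule idealI)
    show "subgroup (face_ideal S F) (add_monoid (semigroup_ring S :: ('a \<Rightarrow>\<^sub>0 'k) ring))"
    proof (rule add.subgroupI)
      show "(face_ideal S F :: ('a \<Rightarrow>\<^sub>0 'k) set) \<noteq> {}"
        by (auto simp: face_ideal_def intro!: exI[of _ 0])
    next
      fix f g :: "'a \<Rightarrow>\<^sub>0 'k" assume "f \<in> face_ideal S F" "g \<in> face_ideal S F"
      then show "f \<oplus>\<^bsub>semigroup_ring S\<^esub> g \<in> face_ideal S F"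
        using keys_add[of f g] by (fastforce simp: face_ideal_def semigroup_ring_def)
    next
      fix f :: "'a \<Rightarrow>\<^sub>0 'k" assume f: "f \<in> face_ideal S F"
      then have "f \<in> carrier (semigroup_ring S)" by (auto simp: face_ideal_def semigroup_ring_def)
      with f show "\<ominus>\<^bsub>semigroup_ring S\<^esub> f \<in> face_ideal S F"
        by (subst inv) (auto simp: face_ideal_def in_keys_iff)
    qed (auto simp: face_ideal_def semigroup_ring_def)
  next
    fix f g :: "'a \<Rightarrow>\<^sub>0 'k" assume fg: "f \<in> face_ideal S F" "g \<in> carrier (semigroup_ring S)"
    show "g \<otimes>\<^bsub>semigroup_ring S\<^esub> f \<in> face_ideal S F" "f \<otimes>\<^bsub>semigroup_ring S\<^esub> g \<in> face_ideal S F"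
      using mult[OF fg] by (simp_all add: semigroup_ring_def mult.commute)
  qed (rule ring_axioms)
qed

lemma primeideal_face_ideal:
  fixes S :: "(nat \<times> nat) set"
  assumes "0 \<in> S" "\<And>x y. x \<in> S \<Longrightarrow> y \<in> S \<Longrightarrow> x + y \<in> S" "face F"
  shows "primeideal (face_ideal S F) (semigroup_ring S :: (nat \<times> nat \<Rightarrow>\<^sub>0 'k::field) ring)"
proof (rule primeidealI)
  have "1 \<in> carrier (semigroup_ring S :: (nat \<times> nat \<Rightarrow>\<^sub>0 'k) ring)"
    "(1 :: nat \<times> nat \<Rightarrow>\<^sub>0 'k) \<notin> face_ideal S F"
    using assms by (auto simp: semigroup_ring_def face_ideal_def face_def)
  then show "carrier (semigroup_ring S :: (nat \<times> nat \<Rightarrow>\<^sub>0 'k) ring) \<noteq> face_ideal S F" by blast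
next
  fix f g :: "nat \<times> nat \<Rightarrow>\<^sub>0 'k"
  assume "f \<in> carrier (semigroup_ring S)" "g \<in> carrier (semigroup_ring S)"
    "f \<otimes>\<^bsub>semigroup_ring S\<^esub> g \<in> face_ideal S F"
  then show "f \<in> face_ideal S F \<or> g \<in> face_ideal S F"
    using keys_mult_meets_face[OF assms(3), of f g]
    by (auto simp: semigroup_ring_def face_ideal_def)
next
  show "ideal (face_ideal S F) (semigroup_ring S :: (nat \<times> nat \<Rightarrow>\<^sub>0 'k) ring)"
    by (rule ideal_face_ideal[OF assms])
  show "cring (semigroup_ring S :: (nat \<times> nat \<Rightarrow>\<^sub>0 'k) ring)"
    by (rule cring_semigroup_ring[OF assms(1,2)])
qed

text \<open>The residue ring is the coefficient field: an element outside the ideal has a nonzero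
  constant term, so together with the ideal it generates a unit.\<close>

lemma maximalideal_face_ideal_0:
  fixes S :: "'a::comm_monoid_add set"
  assumes "0 \<in> S" "\<And>x y. x \<in> S \<Longrightarrow> y \<in> S \<Longrightarrow> x + y \<in> S" "face {0 :: 'a}"
  shows "maximalideal (face_ideal S {0}) (semigroup_ring S :: ('a \<Rightarrow>\<^sub>0 'k::field) ring)"
proof (rule maximalidealI)
  show "ideal (face_ideal S {0}) (semigroup_ring S :: ('a \<Rightarrow>\<^sub>0 'k) ring)"
    by (rule ideal_face_ideal[OF assms])
  have "1 \<in> carrier (semigroup_ring S :: ('a \<Rightarrow>\<^sub>0 'k) ring)" "(1 :: 'a \<Rightarrow>\<^sub>0 'k) \<notin> face_ideal S {0}"
    using assms by (auto simp: semigroup_ring_def face_ideal_def)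
  then show "carrier (semigroup_ring S :: ('a \<Rightarrow>\<^sub>0 'k) ring) \<noteq> face_ideal S {0}" by blast
next
  fix J :: "('a \<Rightarrow>\<^sub>0 'k) set"
  assume J: "ideal J (semigroup_ring S)" "face_ideal S {0} \<subseteq> J" "J \<subseteq> carrier (semigroup_ring S)"
  interpret J: ideal J "semigroup_ring S" by (rule J(1))
  show "J = face_ideal S {0} \<or> J = carrier (semigroup_ring S)"
  proof (cases "J \<subseteq> face_ideal S {0}")
    case False
    then obtain f where f: "f \<in> J" "f \<notin> face_ideal S {0}" by blast
    define c where "c = Poly_Mapping.lookup f 0"
    have S: "Poly_Mapping.keys f \<subseteq> S" using f J(3) by (auto simp: semigroup_ring_def)
    with f(2) have "c \<noteq> 0" by (auto simp: face_ideal_def c_def in_keys_iff)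
    \<comment> \<open>Adding \<open>h\<close> to \<open>f\<close> removes all terms except the
      constant \<open>c\<close>, and \<open>h\<close> itself has no constant term.\<close>
    define h where "h = Poly_Mapping.single 0 c - f"
    have "h \<in> face_ideal S {0}"
      using S assms(1)
      by (auto simp: h_def face_ideal_def in_keys_iff lookup_minus lookup_single c_def when_def split: if_splits)
    with J(2) f(1) have "h \<oplus>\<^bsub>semigroup_ring S\<^esub> f \<in> J" by blast
    then have "Poly_Mapping.single 0 c \<in> J" by (simp add: h_def semigroup_ring_def)
    moreover have "Poly_Mapping.single 0 (inverse c) \<in> carrier (semigroup_ring S)"
      using assms(1) by (auto simp: semigroup_ring_def)
    ultimately have "Poly_Mapping.single 0 (inverse c) \<otimes>\<^bsub>semigroup_ring S\<^esub> Poly_Mapping.single 0 c \<in> J"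
      by (rule J.I_l_closed)
    then have "\<one>\<^bsub>semigroup_ring S\<^esub> \<in> J"
      using \<open>c \<noteq> 0\<close> by (simp add: semigroup_ring_def mult_single)
    then show ?thesis by (simp add: J.one_imp_carrier)
  qed (use J(2) in blast)
qed

section \<open>Height and depth at the irrelevant ideal\<close>

lemma prime_height_face_ideal_0:
  fixes S :: "(nat \<times> nat) set"
  assumes "0 \<in> S" "\<And>x y. x \<in> S \<Longrightarrow> y \<in> S \<Longrightarrow> x + y \<in> S"
    and "(0, p) \<in> S" "p > 0" "(q, 0) \<in> S" "q > 0"
  shows "prime_height (semigroup_ring S :: (nat \<times> nat \<Rightarrow>\<^sub>0 'k::field) ring) (face_ideal S {0}) \<ge> 2"
proof -
  \<comment> \<open>The quadrant, the axis of points with first coordinate 0, and the origin: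
    decreasing faces give increasing primes.\<close>
  define F where "F = (\<lambda>i::nat. if i = 0 then UNIV else if i = 1 then {u :: nat \<times> nat. fst u = 0} else {0})"
  have face: "face (F i)" for i
    by (auto simp: F_def face_def prod_eq_iff)
  have sub: "face_ideal S (F i) \<subset> (face_ideal S (F (Suc i)) :: (nat \<times> nat \<Rightarrow>\<^sub>0 'k) set)" if "i < 2" for i
  proof -
    have "F (Suc i) \<subseteq> F i" using that by (auto simp: F_def)
    then have "face_ideal S (F i) \<subseteq> (face_ideal S (F (Suc i)) :: (nat \<times> nat \<Rightarrow>\<^sub>0 'k) set)"
      by (auto simp: face_ideal_def)
    \<comment> \<open>The monomial at \<open>(q, 0)\<close> separates the axis prime from the zero
      ideal; the one at \<open>(0, p)\<close> separates the irrelevant ideal from the axis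
      prime.\<close>
    moreover have "Poly_Mapping.single (if i = 0 then (q, 0) else (0, p)) 1 \<in>
        face_ideal S (F (Suc i)) - (face_ideal S (F i) :: (nat \<times> nat \<Rightarrow>\<^sub>0 'k) set)"
      using assms that by (auto simp: face_ideal_def F_def prod_eq_iff)
    ultimately show ?thesis by blast
  qed
  have F2: "F 2 = {0}" by (simp add: F_def)
  have "2 \<in> {n. \<exists>Q. (\<forall>i\<le>n. primeideal (Q i) (semigroup_ring S :: (nat \<times> nat \<Rightarrow>\<^sub>0 'k) ring)) \<and>
      (\<forall>i<n. Q i \<subset> Q (Suc i)) \<and> Q n = face_ideal S {0}}"
    using primeideal_face_ideal[OF assms(1,2) face] sub
    by (intro CollectI exI[of _ "\<lambda>i. face_ideal S (F i)"] conjI allI impI) (simp_all add: F2)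
  then have "enat 2 \<le> prime_height (semigroup_ring S :: (nat \<times> nat \<Rightarrow>\<^sub>0 'k) ring) (face_ideal S {0})"
    unfolding prime_height_def by (rule SUP_upper)
  then show ?thesis by (simp add: numeral_eq_enat)
qed

text \<open>If \<open>f, g\<close> is regular, then \<open>g (f t\<^sup>z) = f (g t\<^sup>z)\<close> forces \<open>f t\<^sup>z \<in> (f)\<close>, hence \<open>z \<in> S\<close>.\<close>
lemma regular_sequence_length_le_1:
  fixes S :: "(nat \<times> nat) set" and xs :: "(nat \<times> nat \<Rightarrow>\<^sub>0 'k::field) list"
  assumes S: "0 \<in> S" "\<And>x y. x \<in> S \<Longrightarrow> y \<in> S \<Longrightarrow> x + y \<in> S"
    and z: "z \<notin> S" "\<And>s. s \<in> S \<Longrightarrow> s \<noteq> 0 \<Longrightarrow> s + z \<in> S"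
    and xs: "regular_sequence (semigroup_ring S) xs" "set xs \<subseteq> face_ideal S {0}"
  shows "length xs \<le> 1"
proof (rule ccontr)
  let ?R = "semigroup_ring S :: (nat \<times> nat \<Rightarrow>\<^sub>0 'k) ring"
  interpret cring ?R by (rule cring_semigroup_ring[OF S])
  assume "\<not> length xs \<le> 1"
  then obtain f g ys where xs_eq: "xs = f # g # ys"
    by (metis One_nat_def le_refl le_SucI length_0_conv length_Cons list.exhaust zero_le)
  have f: "f \<in> carrier ?R" "f \<in> face_ideal S {0}" and g: "g \<in> carrier ?R" "g \<in> face_ideal S {0}"
    using xs by (auto simp: xs_eq regular_sequence_def)
  have reg: "y \<in> Idl\<^bsub>?R\<^esub> set (take i xs)"
    if "i < 2" "y \<in> carrier ?R" "xs ! i * y \<in> Idl\<^bsub>?R\<^esub> set (take i xs)" for i y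
    using xs(1) that unfolding regular_sequence_def by (auto simp: xs_eq semigroup_ring_def)
  have "Idl\<^bsub>?R\<^esub> {} \<subseteq> {\<zero>\<^bsub>?R\<^esub>}" by (rule genideal_minimal[OF zeroideal]) simp
  moreover have "\<zero>\<^bsub>?R\<^esub> \<in> Idl\<^bsub>?R\<^esub> {}"
    using genideal_ideal[of "{}"] additive_subgroup.zero_closed ideal_def by blast
  ultimately have Idl0: "Idl\<^bsub>?R\<^esub> {} = {0}" by (auto simp: semigroup_ring_def)
  have "f \<noteq> 0"
  \<comment> \<open>If \<open>f = 0\<close>, then regularity of the first entry, tested on 1, would
    put 1 into the zero ideal.\<close>
  proof
    assume "f = 0"
    with reg[of 0 1] S show False by (simp add: xs_eq Idl0) (simp add: semigroup_ring_def)
  qed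
  define t where "t = (Poly_Mapping.single z 1 :: nat \<times> nat \<Rightarrow>\<^sub>0 'k)"
  \<comment> \<open>The monomial \<open>t\<close> is not in the ring, but every element without
    constant term multiplies it into the ring.\<close>
  have shift: "h * t \<in> carrier ?R" if "h \<in> face_ideal S {0}" for h
    using that z(2) keys_mult[of h t] by (fastforce simp: t_def semigroup_ring_def face_ideal_def)
  have PIdl: "Idl\<^bsub>?R\<^esub> {f} = {h * f | h. h \<in> carrier ?R}"
    using cgenideal_eq_genideal[OF f(1)] by (auto simp: cgenideal_def semigroup_ring_def)
  have "g * (f * t) = (g * t) * f" by (simp add: algebra_simps)
  then have "g * (f * t) \<in> Idl\<^bsub>?R\<^esub> {f}" using shift[OF g(2)] unfolding PIdl by blast
  with reg[of 1 "f * t"] shift[OF f(2)] have "f * t \<in> Idl\<^bsub>?R\<^esub> {f}" by (simp add: xs_eq)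
  then obtain h where h: "h \<in> carrier ?R" "f * t = h * f" by (auto simp: PIdl)
  \<comment> \<open>The factor \<open>f\<close> is cancelled in the monoid ring of the whole
    quadrant, a domain that also contains \<open>t\<close>.\<close>
  then have "f * (t - h) = 0" by (simp add: algebra_simps)
  with \<open>f \<noteq> 0\<close> have "t = h" using poly_mapping_mult_eq_0 by fastforce
  with h(1) z(1) show False by (auto simp: t_def semigroup_ring_def)
qed

lemma not_cohen_macaulay_semigroup_ring:
  fixes S :: "(nat \<times> nat) set"
  assumes "0 \<in> S" "\<And>x y. x \<in> S \<Longrightarrow> y \<in> S \<Longrightarrow> x + y \<in> S"
    and "(0, p) \<in> S" "p > 0" "(q, 0) \<in> S" "q > 0"
    and "z \<notin> S" "\<And>s. s \<in> S \<Longrightarrow> s \<noteq> 0 \<Longrightarrow> s + z \<in> S"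
  shows "\<not> cohen_macaulay (semigroup_ring S :: (nat \<times> nat \<Rightarrow>\<^sub>0 'k::field) ring)"
proof
  let ?R = "semigroup_ring S :: (nat \<times> nat \<Rightarrow>\<^sub>0 'k) ring"
  assume "cohen_macaulay ?R"
  moreover have "face {0 :: nat \<times> nat}" by (auto simp: face_def prod_eq_iff)
  ultimately have "ideal_depth ?R (face_ideal S {0}) = prime_height ?R (face_ideal S {0})"
    using maximalideal_face_ideal_0[OF assms(1,2)] by (auto simp: cohen_macaulay_def)
  moreover have "ideal_depth ?R (face_ideal S {0}) \<le> enat 1"
    unfolding ideal_depth_def
    using regular_sequence_length_le_1[OF assms(1,2,7,8)] by (intro SUP_least) auto
  moreover have "enat 2 \<le> prime_height ?R (face_ideal S {0})"
    using prime_height_face_ideal_0[OF assms(1-6), where 'k = 'k] by (simp add: numeral_eq_enat)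
  ultimately have "enat 2 \<le> enat 1" by (metis order_trans)
  then show False by simp
qed

section \<open>Generated monoids and socle elements\<close>

lemma monoid_hull_base: "g \<in> G \<Longrightarrow> g \<in> monoid_hull G"
  using monoid_hull.add[OF _ monoid_hull.zero] by force

lemma monoid_hull_plus:
  assumes "x \<in> monoid_hull G" "y \<in> monoid_hull G"
  shows "x + y \<in> monoid_hull G"
  using assms by (induction rule: monoid_hull.induct) (auto simp: add.assoc intro: monoid_hull.add)

lemma monoid_hull_scale:
  fixes G :: "(nat \<times> nat) set"
  assumes "(u, v) \<in> monoid_hull G"
  shows "(n * u, n * v) \<in> monoid_hull G"
proof (induction n)
  case 0
  show ?case using monoid_hull.zero[of G] by (simp add: zero_prod_def)
next
  case (Suc n)
  show ?case using monoid_hull_plus[OF assms Suc] by simp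
qed

text \<open>Generator by generator, replace \<open>x\<close> by \<open>x + m g\<close> with \<open>m\<close> maximal such that the result is
  not in the monoid.\<close>
lemma exists_socle_element:
  fixes G :: "'a::comm_monoid_add set"
  assumes "finite G" "x \<notin> monoid_hull G" "\<And>g. g \<in> G \<Longrightarrow> \<exists>n. ((+) g ^^ n) x \<in> monoid_hull G"
  obtains z where "z \<notin> monoid_hull G" "\<And>s. s \<in> monoid_hull G \<Longrightarrow> s \<noteq> 0 \<Longrightarrow> s + z \<in> monoid_hull G"
proof -
  have funpow_add: "((+) g ^^ n) (y + s) = ((+) g ^^ n) y + s" for g y s :: 'a and n
    by (induction n) (auto simp: add.assoc)
  have funpow_mem: "((+) g ^^ n) y \<in> monoid_hull G" if "g \<in> G" "y \<in> monoid_hull G" for g y n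
    using that by (induction n) (auto intro: monoid_hull.add)
  \<comment> \<open>Requiring \<open>s\<close> to lie in the monoid is what lets the induction
    continue: translation by \<open>s\<close> preserves the hypothesis that multiples of each
    generator move \<open>x\<close> inside.\<close>
  have "\<exists>s\<in>monoid_hull G. x + s \<notin> monoid_hull G \<and> (\<forall>g\<in>H. g + (x + s) \<in> monoid_hull G)" if "H \<subseteq> G" for H
    using finite_subset[OF that \<open>finite G\<close>] that
  proof (induction H rule: finite_induct)
    case empty
    show ?case using assms(2) by (intro bexI[of _ 0]) (auto intro: monoid_hull.zero)
  next
    case (insert g H)
    then obtain s where s: "s \<in> monoid_hull G" "x + s \<notin> monoid_hull G"
      "\<And>h. h \<in> H \<Longrightarrow> h + (x + s) \<in> monoid_hull G" and g: "g \<in> G"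
      by auto
    obtain n where "((+) g ^^ n) x \<in> monoid_hull G" using assms(3)[OF g] by blast
    then have n: "((+) g ^^ n) (x + s) \<in> monoid_hull G"
      using s(1) by (simp add: funpow_add monoid_hull_plus)
    \<comment> \<open>As \<open>x + s\<close> lies outside, \<open>l\<close> is positive; its
      predecessor \<open>m\<close> gives a point outside that one more \<open>g\<close> moves
      inside.\<close>
    define l where "l = (LEAST n. ((+) g ^^ n) (x + s) \<in> monoid_hull G)"
    have l: "((+) g ^^ l) (x + s) \<in> monoid_hull G" unfolding l_def using n by (rule LeastI)
    with s(2) obtain m where m: "l = Suc m" by (cases l) auto
    then have notin: "((+) g ^^ m) (x + s) \<notin> monoid_hull G"
      using not_less_Least[of m "\<lambda>n. ((+) g ^^ n) (x + s) \<in> monoid_hull G"] by (simp add: l_def)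
    have eq: "x + ((+) g ^^ m) s = ((+) g ^^ m) (x + s)"
      using funpow_add[of m g s x] by (simp add: add.commute)
    have "h + ((+) g ^^ m) (x + s) \<in> monoid_hull G" if "h \<in> insert g H" for h
    proof (cases "h = g")
      case True
      with l show ?thesis by (simp add: m)
    next
      case False
      \<comment> \<open>Generators treated earlier stay good: \<open>h + (x + s)\<close> is already
        inside, and adding copies of \<open>g\<close> keeps it there.\<close>
      have "h + ((+) g ^^ m) (x + s) = ((+) g ^^ m) (h + (x + s))"
        using funpow_add[of m g "x + s" h] by (simp add: add.commute)
      with False that s(3) g show ?thesis by (auto intro: funpow_mem)
    qed
    with notin s(1) g show ?case
      by (intro bexI[of _ "((+) g ^^ m) s"]) (auto simp: eq intro: funpow_mem)
  qed
  from this[OF subset_refl] obtain z where z: "z \<notin> monoid_hull G" "\<And>g. g \<in> G \<Longrightarrow> g + z \<in> monoid_hull G"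
    by blast
  have "s + z \<in> monoid_hull G" if "s \<in> monoid_hull G" "s \<noteq> 0" for s
    using that(1)
  proof cases
    case (add g y)
    then show ?thesis
      using monoid_hull_plus[OF add(3) z(2)[OF add(2)]] by (simp add: ac_simps)
  qed (use that in simp)
  with z that show thesis by blast
qed

section \<open>Gaps between the intervals and elements of least degree\<close>

text \<open>Monotonicity on an initial segment, because \<open>a\<close> and \<open>b\<close> are
  constrained only up to \<open>k\<close> and \<open>2 * r + 1\<close>.\<close>

lemma le_of_steps:
  fixes f :: "nat \<Rightarrow> 'a::preorder"
  assumes "\<And>i. i < n \<Longrightarrow> f i \<le> f (Suc i)" "i \<le> j" "j \<le> n"
  shows "f i \<le> f j"
  using assms(2,3)
proof (induction j rule: dec_induct)
  case (step m)
  then show ?case using assms(1)[of m] by (auto intro: order_trans)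
qed simp

text \<open>The endpoints increase with their index, so intervals before the \<open>j\<close>-th end
  by \<open>b (2 * j - 1)\<close> and the others start no earlier than
  \<open>b (2 * j)\<close>.\<close>

lemma interval_gap_notin:
  fixes b :: "nat \<Rightarrow> nat"
  assumes "\<forall>j\<le>r. b (2 * j) \<le> b (2 * j + 1)"
    and "\<forall>j\<in>{1..r}. b (2 * j - 1) + 2 \<le> b (2 * j)"
    and "j \<in> {1..r}" "b (2 * j - 1) < n" "n < b (2 * j)"
  shows "n \<notin> (\<Union>j\<in>{0..r}. {b (2 * j)..b (2 * j + 1)})"
proof
  have step: "b m \<le> b (Suc m)" if "m < 2 * r + 1" for m
  proof (cases "even m")
    case True
    with that assms(1) show ?thesis by (auto elim!: evenE)
  next
    case False
    then obtain i where i: "m = 2 * i + 1" by (auto elim: oddE)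
    with that have "Suc i \<in> {1..r}" by auto
    with assms(2) have "b (2 * Suc i - 1) + 2 \<le> b (2 * Suc i)" by blast
    with i show ?thesis by simp
  qed
  have mono: "b m \<le> b n" if "m \<le> n" "n \<le> 2 * r + 1" for m n
    using le_of_steps[of "2 * r + 1" b m n] step that by blast
  assume "n \<in> (\<Union>j\<in>{0..r}. {b (2 * j)..b (2 * j + 1)})"
  then obtain i where i: "i \<le> r" "b (2 * i) \<le> n" "n \<le> b (2 * i + 1)" by auto
  show False
  proof (cases "i < j")
    case True
    then have "b (2 * i + 1) \<le> b (2 * j - 1)" using assms(3) by (intro mono) auto
    with i assms(4) show False by linarith
  next
    case False
    then have "b (2 * j) \<le> b (2 * i)" using i(1) by (intro mono) auto
    with i assms(5) show False by linarith
  qed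
qed

text \<open>Zero has degree 0 and a sum of two or more generators has degree at least
  \<open>2 * d\<close>; this leaves only single generators in degree \<open>d\<close>.\<close>

lemma monoid_hull_degree:
  fixes G :: "(nat \<times> nat) set"
  assumes "\<And>g. g \<in> G \<Longrightarrow> fst g + snd g = d" "s \<in> monoid_hull G" "fst s + snd s = d" "d > 0"
  shows "s \<in> G"
proof -
  have "s = 0 \<or> s \<in> G \<or> fst s + snd s \<ge> 2 * d"
    using assms(2)
  proof (induction rule: monoid_hull.induct)
    case (add g x)
    then show ?case using assms(1)[of g] assms(1)[of x] by auto
  qed simp
  with assms show ?thesis by auto
qed

section \<open>The point in the gap before the chosen interval\<close>

theorem corollary3p8:
  fixes k d r last_gap :: nat and a b :: "nat \<Rightarrow> nat"
  assumes "k \<ge> 3"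
    and "a 0 = 0"
    and "\<forall>i<k. a i < a (Suc i)"
    and "a k = d"
    and "Gcd (a ` {1..k}) = 1"
    and "r \<ge> 1"
    and "b 0 = 0"
    and "b (2 * r + 1) = d"
    and "\<forall>j\<le>r. b (2 * j) \<le> b (2 * j + 1)"
    and "\<forall>j\<in>{1..r}. b (2 * j - 1) + 2 \<le> b (2 * j)"
    and "a ` {0..k} = (\<Union>j\<in>{0..r}. {b (2 * j)..b (2 * j + 1)})"
    and "a 1 = 1"
    and "last_gap = a k - a (k - 1) - 1"
    and "\<exists>j\<in>{1..r}. b (2 * j + 1) - b (2 * j - 1) \<ge> last_gap + 2"
  shows "\<not> cohen_macaulay
           (semigroup_ring (projective_monoid k a) :: ((nat \<times> nat) \<Rightarrow>\<^sub>0 'k::field) ring)"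
proof -
  let ?G = "(\<lambda>i. (a i, d - a i)) ` {0..k}"
  let ?M = "monoid_hull ?G"
  have M: "projective_monoid k a = ?M" by (simp add: projective_monoid_def assms(4))
  have mono: "a i \<le> a j" if "i \<le> j" "j \<le> k" for i j
    using assms(3) by (intro le_of_steps[OF _ that]) (simp add: less_imp_le)
  have le_d: "a i \<le> d" if "i \<le> k" for i using mono[of i k] that assms(4) by simp
  have memI: "(c, d - c) \<in> ?M" if "c \<in> a ` {0..k}" for c
    using that by (intro monoid_hull_base) auto
  have "a (k - 1) < d" using assms(3)[rule_format, of "k - 1"] assms(1,4) by simp
  define g where "g = d - a (k - 1)"
  have g: "g \<ge> 1" "g = last_gap + 1" "d - g = a (k - 1)" "g \<le> d"
    using \<open>a (k - 1) < d\<close> assms(4,13) by (auto simp: g_def)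
  obtain j where j: "j \<in> {1..r}" "b (2 * j + 1) - b (2 * j - 1) \<ge> last_gap + 2" using assms(14) by blast
  have bj: "b (2 * j - 1) + 2 \<le> b (2 * j)" "b (2 * j) \<le> b (2 * j + 1)"
    using assms(9,10) j(1) by auto
  define y where "y = max (b (2 * j)) (b (2 * j - 1) + g + 1)"
  \<comment> \<open>The upper bound is the hypothesis on \<open>j\<close>, since
    \<open>last_gap + 2\<close> equals \<open>g + 1\<close>.\<close>
  have y: "b (2 * j) \<le> y" "y \<le> b (2 * j + 1)" using j(2) bj g(2) by (auto simp: y_def)
  \<comment> \<open>When the second argument of the maximum is attained, \<open>y - g\<close> is
    \<open>b (2 * j - 1) + 1\<close>, still below \<open>b (2 * j)\<close> because the gap contains
    an integer.\<close>
  have gap: "b (2 * j - 1) < y - g" "y - g < b (2 * j)" "g \<le> y" using bj g(1) by (auto simp: y_def)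
  have yA: "y \<in> a ` {0..k}" unfolding assms(11) using j(1) y by auto
  have "y \<le> d" using yA le_d by auto
  define N where "N = y - g"
  have N: "N \<ge> 1" "N \<le> d" "N + g = y" using gap \<open>y \<le> d\<close> by (auto simp: N_def)
  have NA: "N \<notin> a ` {0..k}"
    unfolding assms(11) N_def by (rule interval_gap_notin[OF assms(9,10) j(1) gap(1,2)])
  have "d > 0" using N by simp
  have e0: "(0, d) \<in> ?M" using memI[of "a 0"] assms(2) by simp
  have ek: "(d, 0) \<in> ?M" using memI[of d] assms(4) by (simp add: rev_image_eqI[of k])
  have notin: "(N, d - N) \<notin> ?M"
  proof
    assume "(N, d - N) \<in> ?M"
    moreover have "fst p + snd p = d" if "p \<in> ?G" for p using that le_d by auto
    ultimately have "(N, d - N) \<in> ?G"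
      using monoid_hull_degree[of ?G d "(N, d - N)"] N(2) \<open>d > 0\<close> by simp
    with NA show False by auto
  qed
  have pow: "((+) (u, v) ^^ n) (s, t) = (s + n * u, t + n * v)" for u v s t n :: nat
    by (induction n) auto
  have shift_ek: "(N + d, d - N) \<in> ?M"
  proof -
    have "a (k - 1) \<in> a ` {0..k}" by simp
    note monoid_hull_plus[OF memI[OF yA] memI[OF this]]
    moreover have "y + a (k - 1) = N + d" "d - y + (d - a (k - 1)) = d - N"
      using N(3) g(3,4) \<open>y \<le> d\<close> by linarith+
    ultimately show ?thesis by simp
  qed
  have "\<exists>n. ((+) p ^^ n) (N, d - N) \<in> ?M" if p: "p \<in> ?G" for p
  proof -
    obtain i where i: "i \<le> k" "p = (a i, d - a i)" using p by auto
    show ?thesis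
    proof (cases "i = 0")
      case True
      have "a 1 \<in> a ` {0..k}" using assms(1) by (intro imageI) simp
      from monoid_hull_scale[OF memI[OF this], of N]
      have "(N, N * (d - 1)) \<in> ?M" unfolding assms(12) by simp
      \<comment> \<open>Adding \<open>N - 1\<close> copies of \<open>(0, d)\<close> to
        \<open>(N, d - N)\<close> gives exactly \<open>N\<close> copies of the generator
        \<open>(1, d - 1)\<close>.\<close>
      moreover have "d - N + (N - 1) * d = N * (d - 1)"
      proof -
        obtain c where "N = Suc c" using N(1) by (cases N) auto
        moreover obtain e where "d = N + e" using N(2) le_Suc_ex by blast
        ultimately show ?thesis by (simp add: algebra_simps)
      qed
      ultimately have "((+) p ^^ (N - 1)) (N, d - N) \<in> ?M"
        using True i(2) assms(2) by (simp add: pow)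
      then show ?thesis by blast
    next
      case False
      then have "a i \<ge> 1" using mono[of 1 i] i(1) assms(12) by simp
      \<comment> \<open>Here \<open>d\<close> copies of \<open>p\<close> equal \<open>a i\<close>
        copies of \<open>(d, 0)\<close> plus \<open>d - a i\<close> copies of \<open>(0, d)\<close>.
        One copy of \<open>(d, 0)\<close> is spent on \<open>shift_ek\<close>, which is possible as
        \<open>a i\<close> is positive.\<close>
      have "(N + d, d - N) + ((a i - 1) * d, (a i - 1) * 0) + ((d - a i) * 0, (d - a i) * d) \<in> ?M"
        by (intro monoid_hull_plus monoid_hull_scale shift_ek e0 ek)
      moreover have "N + d + (a i - 1) * d = N + d * a i"
        using \<open>a i \<ge> 1\<close> by (cases "a i") (auto simp: algebra_simps)
      ultimately have "(N + d * a i, d - N + d * (d - a i)) \<in> ?M"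
        by (simp only: add_Pair mult_0_right add_0_right mult.commute[of "d - a i" d])
      then have "((+) p ^^ d) (N, d - N) \<in> ?M"
        by (simp add: i(2) pow)
      then show ?thesis by blast
    qed
  qed
  then obtain z where z: "z \<notin> ?M" "\<And>s. s \<in> ?M \<Longrightarrow> s \<noteq> 0 \<Longrightarrow> s + z \<in> ?M"
    using exists_socle_element[OF _ notin] by blast
  show ?thesis
    unfolding M
  proof (rule not_cohen_macaulay_semigroup_ring)
    show "0 \<in> ?M" by (rule monoid_hull.zero)
    show "x + y \<in> ?M" if "x \<in> ?M" "y \<in> ?M" for x y using that by (rule monoid_hull_plus)
  qed (fact e0 ek z \<open>d > 0\<close>)+
qed

end
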